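(* Let $h\geq 1$ and $n\geq 1$ be integers and let $\mathbf{t}=(t_1,\dots,t_n)$ be an $h$-depth neighborhood, i.e. an $n$-tuple of unlabeled rooted trees each of depth at most $h$. Then $\mathbf{t}$ is graphical if and only if both of the following hold: (i) for every type $\tau\in\Delta$, the integer sequence $(d^\tau_i)_{i\in[n]}$ is graphical, i.e. there is a simple graph on vertex set $[n]$ in which vertex $i$ has degree $d^\tau_i$ for all $i$; (ii) for every $\tau\in A$, the double sequence $(d^\tau_i,d^{\tau^{-1}}_i)_{i\in[n]}$ is digraphical, i.e. there is a digraph on vertex set $[n]$ without loops and without multiple parallel arcs in which vertex $i$ has out-degree $d^\tau_i$ and in-degree $d^{\tau^{-1}}_i$ for all $i$.
   Context: All trees are unlabeled rooted trees; the root is denoted $\bullet$, and for a rooted tree $g$ and integer $k$, $(g)_k$ is the ball of radius $k$ around the root. For a graph $G$ and a vertex $x$, the universal covering tree $T_G$ rooted at $x$ can be described as the tree whose vertices are the non-backtracking walks in $G$ starting at $x$ (rooted at the trivial walk), a walk being adjacent to its one-step extensions; the $h$-depth universal covering neighborhood of $x$ is the ball of radius $h$ around the root in this tree, as an unlabeled rooted tree. The tuple $\mathbf{t}$ is called graphical if there exists a simple graph $G$ on vertex set $[n]=\{1,\dots,n\}$ such that for every $i$, the $h$-depth universal covering neighborhood of $i$ in $G$ is isomorphic (as a rooted tree) to $t_i$. Type of an edge: let $t$ be a rooted tree of depth at most $h$ and $e=(\bullet,x)$ an edge incident to the root. Removing $e$ splits $t$ into two components: $r'$ containing the root, and $s$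 containing $x$, which is rooted at $x$. Deleting from $r'$ all vertices that were at depth exactly $h$ in $t$ (keeping root $\bullet$) gives a rooted tree $r$. The type of $e$ is $\tau(e)=(r,s)$, a pair of unlabeled rooted trees of depth at most $h-1$. For a pair $\tau=(r,s)$ its opposite is $\tau^{-1}=(s,r)$. Let $\mathrm{types}(\mathbf{t})$ be the set of types of all root-incident edges of all the $t_i$. Let $\Delta$ be the set of types in $\mathrm{types}(\mathbf{t})$ of the form $(r,r)$. Let $A$ be a set of pairs $(r,s)$ with $r\neq s$ such that for every $\tau=(r,s)\in\mathrm{types}(\mathbf{t})$ with $r\ne s$, exactly one of $\tau,\tau^{-1}$ lies in $A$ (and $A$ contains no other pairs). For any pair $\tau$ and $i\in[n]$, $d^\tau_i$ is the number of edges of $t_i$ incident to the root whose type is $\tau$ (possibly $0$). *)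

theory Defs
  imports Main "HOL-Library.Multiset"
begin

(* Finite unlabeled rooted trees. Since the branches at the root form a multiset,
   equality on this type is isomorphism of rooted trees. *)
datatype rtree = Node (children: "rtree multiset")

primrec depth :: "rtree \<Rightarrow> nat" where
  "depth (Node M) = Max (insert 0 (Suc ` set_mset (image_mset depth M)))"

primrec tree_ball :: "nat \<Rightarrow> rtree \<Rightarrow> rtree" where
  "tree_ball 0 t = Node {#}"
| "tree_ball (Suc k) t = Node (image_mset (tree_ball k) (children t))"

record 'v rooted_graph =
  verts :: "'v set"
  edges :: "'v rel"
  root :: 'v

definition rooted_iso :: "'v rooted_graph \<Rightarrow> 'w rooted_graph \<Rightarrow> bool" where
  "rooted_iso G H \<longleftrightarrow> (\<exists>f. bij_betw f (verts G) (verts H) \<and> f (root G) = root H \<and>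
     (\<forall>u\<in>verts G. \<forall>v\<in>verts G. (u, v) \<in> edges G \<longleftrightarrow> (f u, f v) \<in> edges H))"

definition graph_ball :: "nat \<Rightarrow> 'v rooted_graph \<Rightarrow> 'v rooted_graph" where
  "graph_ball k G = (let B = {v \<in> verts G. \<exists>j\<le>k. (root G, v) \<in> edges G ^^ j}
     in \<lparr>verts = B, edges = edges G \<inter> B \<times> B, root = root G\<rparr>)"

definition extension_edges :: "'a list set \<Rightarrow> 'a list rel" where
  "extension_edges V = {(p, q). p \<in> V \<and> q \<in> V \<and> (\<exists>c. q = p @ [c] \<or> p = q @ [c])}"

(* A tree as a concrete graph: a vertex is the downward path leading to it, where a step (s, i)
   enters the i-th copy of the branch s. *)
primrec path_in :: "(rtree \<times> nat) list \<Rightarrow> rtree \<Rightarrow> bool" where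
  "path_in [] t \<longleftrightarrow> True"
| "path_in (c # p) t \<longleftrightarrow> snd c < count (children t) (fst c) \<and> path_in p (fst c)"

definition graph_of_tree :: "rtree \<Rightarrow> (rtree \<times> nat) list rooted_graph" where
  "graph_of_tree t =
     \<lparr>verts = {p. path_in p t}, edges = extension_edges {p. path_in p t}, root = []\<rparr>"

definition simple_graph :: "nat \<Rightarrow> nat rel \<Rightarrow> bool" where
  "simple_graph n G \<longleftrightarrow> G \<subseteq> {1..n} \<times> {1..n} \<and> sym G \<and> irrefl G"

(* Opposite arcs are allowed; parallel arcs are excluded because the arcs form a set of pairs. *)
definition simple_digraph :: "nat \<Rightarrow> nat rel \<Rightarrow> bool" where
  "simple_digraph n D \<longleftrightarrow> D \<subseteq> {1..n} \<times> {1..n} \<and> irrefl D"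

definition nb_walks :: "'v rel \<Rightarrow> 'v \<Rightarrow> 'v list set" where
  "nb_walks G x = {w. w \<noteq> [] \<and> hd w = x \<and> successively (\<lambda>u v. (u, v) \<in> G) w \<and>
     (\<forall>k. k + 2 < length w \<longrightarrow> w ! k \<noteq> w ! (k + 2))}"

definition universal_cover :: "'v rel \<Rightarrow> 'v \<Rightarrow> 'v list rooted_graph" where
  "universal_cover G x =
     \<lparr>verts = nb_walks G x, edges = extension_edges (nb_walks G x), root = [x]\<rparr>"

definition graphical_nbhd :: "nat \<Rightarrow> nat \<Rightarrow> (nat \<Rightarrow> rtree) \<Rightarrow> bool" where
  "graphical_nbhd h n t \<longleftrightarrow> (\<exists>G. simple_graph n G \<and>
     (\<forall>i\<in>{1..n}. rooted_iso (graph_ball h (universal_cover G i)) (graph_of_tree (t i))))"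

(* The type of a root edge of t leading to a branch s. For depth t \<le> h, restricting to the ball of
   radius h - 1 deletes exactly the vertices at depth h. *)
definition edge_type :: "nat \<Rightarrow> rtree \<Rightarrow> rtree \<Rightarrow> rtree \<times> rtree" where
  "edge_type h t s = (tree_ball (h - 1) (Node (children t - {#s#})), s)"

definition types :: "nat \<Rightarrow> nat \<Rightarrow> (nat \<Rightarrow> rtree) \<Rightarrow> (rtree \<times> rtree) set" where
  "types h n t = {edge_type h (t i) s | i s. i \<in> {1..n} \<and> s \<in># children (t i)}"

definition type_degree :: "nat \<Rightarrow> rtree \<times> rtree \<Rightarrow> rtree \<Rightarrow> nat" where
  "type_degree h \<tau> t = size {#s \<in># children t. edge_type h t s = \<tau>#}"

definition diagonal_types :: "nat \<Rightarrow> nat \<Rightarrow> (nat \<Rightarrow> rtree) \<Rightarrow> (rtree \<times> rtree) set" where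
  "diagonal_types h n t = {(r, s) \<in> types h n t. r = s}"

definition orientation :: "(rtree \<times> rtree) set \<Rightarrow> (rtree \<times> rtree) set \<Rightarrow> bool" where
  "orientation T A \<longleftrightarrow>
     (\<forall>(r, s)\<in>A. r \<noteq> s \<and> ((r, s) \<in> T \<or> (s, r) \<in> T)) \<and>
     (\<forall>(r, s)\<in>T. r \<noteq> s \<longrightarrow> ((r, s) \<in> A) \<noteq> ((s, r) \<in> A))"

definition graphical_seq :: "nat \<Rightarrow> (nat \<Rightarrow> nat) \<Rightarrow> bool" where
  "graphical_seq n d \<longleftrightarrow> (\<exists>G. simple_graph n G \<and> (\<forall>i\<in>{1..n}. card (G `` {i}) = d i))"

definition digraphical_seq :: "nat \<Rightarrow> (nat \<Rightarrow> nat) \<Rightarrow> (nat \<Rightarrow> nat) \<Rightarrow> bool" where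
  "digraphical_seq n dout din \<longleftrightarrow> (\<exists>D. simple_digraph n D \<and>
     (\<forall>i\<in>{1..n}. card (D `` {i}) = dout i \<and> card (D\<inverse> `` {i}) = din i))"

end

theory Submission
  imports Defs "HOL-Combinatorics.Permutations"
begin

text \<open>
  Balls in universal covers and rooted trees are both encoded by prefix-closed sets of lists. If such
  a set has bounded height and branches finitely, its level-by-level unfolding into an unlabeled
  rooted tree determines it up to isomorphism. So \<open>G\<close> realizes \<open>t\<close> iff each \<open>t\<^sub>i\<close> is the unfolding of
  the non-backtracking walks from \<open>i\<close>.

  Necessity: in a realization \<open>G\<close>, the arcs of a fixed type \<open>\<tau>\<close> form a graph (if \<open>\<tau>\<close> is diagonal)
  or a digraph with the prescribed degrees.

  Sufficiency: take the union of the given graphs and digraphs over all types. If \<open>(r, s)\<close> is the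
  type of an edge between \<open>i\<close> and \<open>j\<close>, the ball of radius \<open>k + 1\<close> in \<open>t\<^sub>i\<close> consists of the ball of
  radius \<open>k + 1\<close> in \<open>r\<close> and the ball of radius \<open>k\<close> in \<open>s\<close>, attached to the root of \<open>r\<close>, and
  symmetrically for \<open>t\<^sub>j\<close>. Hence \<open>t\<^sub>i\<close> and \<open>t\<^sub>j\<close> determine \<open>(r, s)\<close>, by induction on \<open>k\<close>. So the
  pieces never overlap, the union is simple, and its universal covers are read off by unfolding the
  types level by level.
\<close>

section \<open>Isomorphisms of rooted graphs\<close>

lemma rooted_iso_sym:
  assumes "rooted_iso G H" "root G \<in> verts G"
  shows "rooted_iso H G"
proof -
  obtain f where f: "bij_betw f (verts G) (verts H)" "f (root G) = root H"
    and adj: "\<And>u v. u \<in> verts G \<Longrightarrow> v \<in> verts G \<Longrightarrow> (u, v) \<in> edges G \<longleftrightarrow> (f u, f v) \<in> edges H"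
    using assms(1) by (auto simp: rooted_iso_def)
  let ?g = "inv_into (verts G) f"
  have g: "bij_betw ?g (verts H) (verts G)"
    by (rule bij_betw_inv_into[OF f(1)])
  moreover have "?g (root H) = root G"
    using bij_betw_inv_into_left[OF f(1) assms(2)] f(2) by simp
  moreover have "(u, v) \<in> edges H \<longleftrightarrow> (?g u, ?g v) \<in> edges G"
    if "u \<in> verts H" "v \<in> verts H" for u v
    using that adj bij_betwE[OF g] bij_betw_inv_into_right[OF f(1)] by metis
  ultimately show ?thesis unfolding rooted_iso_def by blast
qed

lemma rooted_iso_trans:
  assumes "rooted_iso G H" "rooted_iso H K"
  shows "rooted_iso G K"
proof -
  obtain f where f: "bij_betw f (verts G) (verts H)" "f (root G) = root H"
    "\<And>u v. u \<in> verts G \<Longrightarrow> v \<in> verts G \<Longrightarrow> (u, v) \<in> edges G \<longleftrightarrow> (f u, f v) \<in> edges H"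
    using assms(1) by (auto simp: rooted_iso_def)
  obtain g where g: "bij_betw g (verts H) (verts K)" "g (root H) = root K"
    "\<And>u v. u \<in> verts H \<Longrightarrow> v \<in> verts H \<Longrightarrow> (u, v) \<in> edges H \<longleftrightarrow> (g u, g v) \<in> edges K"
    using assms(2) by (auto simp: rooted_iso_def)
  show ?thesis
    unfolding rooted_iso_def using f g bij_betw_trans[OF f(1) g(1)] bij_betwE[OF f(1)]
    by (intro exI[of _ "g \<circ> f"]) simp
qed

lemma relpow_bij_betw_iff:
  assumes f: "bij_betw f A B" and R: "R \<subseteq> A \<times> A" and S: "S \<subseteq> B \<times> B"
    and adj: "\<And>u v. u \<in> A \<Longrightarrow> v \<in> A \<Longrightarrow> (u, v) \<in> R \<longleftrightarrow> (f u, f v) \<in> S"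
    and "u \<in> A" "v \<in> A"
  shows "(u, v) \<in> R ^^ j \<longleftrightarrow> (f u, f v) \<in> S ^^ j"
  using \<open>v \<in> A\<close>
proof (induction j arbitrary: v)
  case 0
  then show ?case using inj_onD[OF bij_betw_imp_inj_on[OF f]] \<open>u \<in> A\<close> by auto
next
  case (Suc j)
  have "(u, v) \<in> R ^^ Suc j \<longleftrightarrow> (\<exists>w\<in>A. (u, w) \<in> R ^^ j \<and> (w, v) \<in> R)"
    using R by auto
  also have "\<dots> \<longleftrightarrow> (\<exists>w\<in>A. (f u, f w) \<in> S ^^ j \<and> (f w, f v) \<in> S)"
    using Suc adj by auto
  also have "\<dots> \<longleftrightarrow> (\<exists>w\<in>B. (f u, w) \<in> S ^^ j \<and> (w, f v) \<in> S)"
    unfolding bij_betw_imp_surj_on[OF f, symmetric] by simp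
  also have "\<dots> \<longleftrightarrow> (f u, f v) \<in> S ^^ Suc j"
    using S by auto
  finally show ?case .
qed

lemma graph_ball_simps:
  "verts (graph_ball k G) = {v \<in> verts G. \<exists>j\<le>k. (root G, v) \<in> edges G ^^ j}"
  "edges (graph_ball k G) = edges G \<inter> verts (graph_ball k G) \<times> verts (graph_ball k G)"
  "root (graph_ball k G) = root G"
  by (simp_all add: graph_ball_def Let_def)

lemma rooted_iso_graph_ball:
  assumes "rooted_iso G H" "root G \<in> verts G"
    and G: "edges G \<subseteq> verts G \<times> verts G" and H: "edges H \<subseteq> verts H \<times> verts H"
  shows "rooted_iso (graph_ball k G) (graph_ball k H)"
proof -
  obtain f where f: "bij_betw f (verts G) (verts H)" and root: "f (root G) = root H"
    and adj: "\<And>u v. u \<in> verts G \<Longrightarrow> v \<in> verts G \<Longrightarrow> (u, v) \<in> edges G \<longleftrightarrow> (f u, f v) \<in> edges H"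
    using assms(1) by (auto simp: rooted_iso_def)
  have "(root G, v) \<in> edges G ^^ j \<longleftrightarrow> (root H, f v) \<in> edges H ^^ j" if "v \<in> verts G" for v j
    unfolding root[symmetric] using relpow_bij_betw_iff[OF f G H adj assms(2) that] .
  then have verts: "f ` verts (graph_ball k G) = verts (graph_ball k H)"
    unfolding graph_ball_simps(1) bij_betw_imp_surj_on[OF f, symmetric] by auto
  have "verts (graph_ball k G) \<subseteq> verts G" by (auto simp: graph_ball_simps(1))
  then have bij: "bij_betw f (verts (graph_ball k G)) (verts (graph_ball k H))"
    using bij_betw_subset[OF f] verts by blast
  moreover have "(u, v) \<in> edges (graph_ball k G) \<longleftrightarrow> (f u, f v) \<in> edges (graph_ball k H)"
    if "u \<in> verts (graph_ball k G)" "v \<in> verts (graph_ball k G)" for u v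
    using that bij_betwE[OF bij] adj[of u v] \<open>verts (graph_ball k G) \<subseteq> verts G\<close>
    by (auto simp: graph_ball_simps(2))
  ultimately show ?thesis
    unfolding rooted_iso_def using root by (intro exI[of _ f]) (simp add: graph_ball_simps(3))
qed

section \<open>Prefix-closed sets of lists as rooted trees\<close>

definition prefix_closed :: "'a list set \<Rightarrow> bool" where
  "prefix_closed V \<longleftrightarrow> [] \<in> V \<and> (\<forall>p q. p @ q \<in> V \<longrightarrow> p \<in> V)"

definition finitely_branching :: "'a list set \<Rightarrow> bool" where
  "finitely_branching V \<longleftrightarrow> (\<forall>p. finite {c. p @ [c] \<in> V})"

definition list_graph :: "'a list set \<Rightarrow> 'a list rooted_graph" where
  "list_graph V = \<lparr>verts = V, edges = extension_edges V, root = []\<rparr>"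

definition first_steps :: "'a list set \<Rightarrow> 'a set" where
  "first_steps V = {c. [c] \<in> V}"

definition subtree :: "'a list set \<Rightarrow> 'a \<Rightarrow> 'a list set" where
  "subtree V c = {p. c # p \<in> V}"

lemma prefix_closed_Nil: "prefix_closed V \<Longrightarrow> [] \<in> V"
  by (simp add: prefix_closed_def)

lemma prefix_closed_appendD: "prefix_closed V \<Longrightarrow> p @ q \<in> V \<Longrightarrow> p \<in> V"
  by (auto simp: prefix_closed_def)

lemma prefix_closed_Cons_iff:
  assumes "prefix_closed V"
  shows "c # p \<in> V \<longleftrightarrow> c \<in> first_steps V \<and> p \<in> subtree V c"
  using prefix_closed_appendD[OF assms, of "[c]" p] by (auto simp: first_steps_def subtree_def)

lemma prefix_closed_eq_Cons_subtrees:
  assumes "prefix_closed V"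
  shows "V = insert [] (\<Union>c\<in>first_steps V. (#) c ` subtree V c)"
proof (rule set_eqI)
  show "p \<in> V \<longleftrightarrow> p \<in> insert [] (\<Union>c\<in>first_steps V. (#) c ` subtree V c)" for p
    by (cases p) (auto simp: prefix_closed_Nil[OF assms] prefix_closed_Cons_iff[OF assms])
qed

lemma prefix_closed_subtree:
  assumes "prefix_closed V" "c \<in> first_steps V"
  shows "prefix_closed (subtree V c)"
  using assms unfolding prefix_closed_def first_steps_def subtree_def
  by (metis append_Cons mem_Collect_eq)

lemma prefix_closed_truncate: "prefix_closed V \<Longrightarrow> prefix_closed {p \<in> V. length p \<le> k}"
  by (auto simp: prefix_closed_def)

lemma finite_first_steps: "finitely_branching V \<Longrightarrow> finite (first_steps V)"
  unfolding finitely_branching_def first_steps_def by (drule spec[of _ "[]"]) simp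

lemma finitely_branching_subtree: "finitely_branching V \<Longrightarrow> finitely_branching (subtree V c)"
  unfolding finitely_branching_def subtree_def by (auto dest: spec[of _ "c # p" for p])

lemma finitely_branching_mono: "V \<subseteq> W \<Longrightarrow> finitely_branching W \<Longrightarrow> finitely_branching V"
  unfolding finitely_branching_def by (blast intro: rev_finite_subset)

lemma relpow_extension_edges_length:
  "(p, q) \<in> extension_edges V ^^ j \<Longrightarrow> length q \<le> length p + j"
proof (induction j arbitrary: q)
  case (Suc j)
  then show ?case by (fastforce simp: extension_edges_def)
qed simp

lemma relpow_extension_edges_from_root:
  assumes "prefix_closed V" "p \<in> V"
  shows "([], p) \<in> extension_edges V ^^ length p"
  using assms(2)
proof (induction p rule: rev_induct)
  case (snoc c p)
  then have "p \<in> V" using prefix_closed_appendD[OF assms(1)] by blast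
  then have "(p, p @ [c]) \<in> extension_edges V"
    using snoc.prems by (auto simp: extension_edges_def)
  then show ?case using snoc.IH[OF \<open>p \<in> V\<close>] by auto
qed simp

lemma graph_ball_list_graph:
  assumes "prefix_closed V"
  shows "graph_ball k (list_graph V) = list_graph {p \<in> V. length p \<le> k}"
proof -
  have "(\<exists>j\<le>k. ([], p) \<in> extension_edges V ^^ j) \<longleftrightarrow> length p \<le> k" if "p \<in> V" for p
    using relpow_extension_edges_length[of "[]" p] relpow_extension_edges_from_root[OF assms that]
    by fastforce
  then have "{p \<in> V. \<exists>j\<le>k. ([], p) \<in> extension_edges V ^^ j} = {p \<in> V. length p \<le> k}"
    by blast
  moreover have "extension_edges V \<inter> {p \<in> V. length p \<le> k} \<times> {p \<in> V. length p \<le> k} =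
      extension_edges {p \<in> V. length p \<le> k}"
    by (auto simp: extension_edges_def)
  ultimately show ?thesis by (simp add: graph_ball_def list_graph_def Let_def)
qed

definition tree_iso :: "('a list \<Rightarrow> 'b list) \<Rightarrow> 'a list set \<Rightarrow> 'b list set \<Rightarrow> bool" where
  "tree_iso f V W \<longleftrightarrow> bij_betw f V W \<and> f [] = [] \<and>
     (\<forall>p c. p @ [c] \<in> V \<longrightarrow> (\<exists>d. f (p @ [c]) = f p @ [d]))"

lemma tree_iso_bij_betw: "tree_iso f V W \<Longrightarrow> bij_betw f V W"
  by (simp add: tree_iso_def)

lemma tree_iso_eq_iff:
  "tree_iso f V W \<Longrightarrow> p \<in> V \<Longrightarrow> q \<in> V \<Longrightarrow> f p = f q \<longleftrightarrow> p = q"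
  by (auto simp: tree_iso_def bij_betw_def inj_on_def)

lemma tree_iso_mem: "tree_iso f V W \<Longrightarrow> p \<in> V \<Longrightarrow> f p \<in> W"
  by (auto simp: tree_iso_def bij_betw_def)

lemma tree_iso_Nil: "tree_iso f V W \<Longrightarrow> f [] = []"
  by (simp add: tree_iso_def)

lemma tree_iso_snoc: "tree_iso f V W \<Longrightarrow> p @ [c] \<in> V \<Longrightarrow> \<exists>d. f (p @ [c]) = f p @ [d]"
  by (simp add: tree_iso_def)

lemma tree_iso_adjacent_iff:
  assumes f: "tree_iso f V W" and V: "prefix_closed V" and "u \<in> V" "v \<in> V"
  shows "(u, v) \<in> extension_edges V \<longleftrightarrow> (f u, f v) \<in> extension_edges W"
proof -
  have snoc_iff: "(\<exists>c. q = p @ [c]) \<longleftrightarrow> (\<exists>d. f q = f p @ [d])" if "p \<in> V" "q \<in> V" for p q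
  proof
    assume "\<exists>c. q = p @ [c]"
    then show "\<exists>d. f q = f p @ [d]" using tree_iso_snoc[OF f] that(2) by blast
  next
    assume "\<exists>d. f q = f p @ [d]"
    then obtain d where d: "f q = f p @ [d]" ..
    then have "q \<noteq> []" using tree_iso_Nil[OF f] by auto
    then obtain q' c where q: "q = q' @ [c]" by (cases q rule: rev_cases) auto
    then have "f q' = f p" using tree_iso_snoc[OF f, of q' c] that(2) d by auto
    moreover have "q' \<in> V" using prefix_closed_appendD[OF V] that(2) q by blast
    ultimately have "q' = p" using tree_iso_eq_iff[OF f] that(1) by blast
    then show "\<exists>c. q = p @ [c]" using q by blast
  qed
  moreover have "f u \<in> W" "f v \<in> W" using tree_iso_mem[OF f] assms(3,4) by auto
  ultimately show ?thesis
    using assms(3,4) unfolding extension_edges_def by auto metis+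
qed

lemma adjacency_preserving_imp_tree_iso:
  assumes V: "prefix_closed V" and f: "bij_betw f V W" "f [] = []"
    and adj: "\<And>u v. u \<in> V \<Longrightarrow> v \<in> V \<Longrightarrow>
      (u, v) \<in> extension_edges V \<longleftrightarrow> (f u, f v) \<in> extension_edges W"
  shows "tree_iso f V W"
proof -
  have "\<exists>d. f (p @ [c]) = f p @ [d]" if "p @ [c] \<in> V" for p c
    using that
  proof (induction p arbitrary: c rule: rev_induct)
    case Nil
    then have "(f [], f [c]) \<in> extension_edges W"
      using adj[of "[]" "[c]"] prefix_closed_Nil[OF V] by (auto simp: extension_edges_def)
    then show ?case using f(2) by (auto simp: extension_edges_def)
  next
    case (snoc b p)
    have V': "p @ [b] \<in> V" "p \<in> V"
      using prefix_closed_appendD[OF V] snoc.prems by fastforce+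
    then obtain d where d: "f (p @ [b]) = f p @ [d]" using snoc.IH by blast
    have "(f (p @ [b]), f ((p @ [b]) @ [c])) \<in> extension_edges W"
      using adj[of "p @ [b]" "(p @ [b]) @ [c]"] V' snoc.prems by (auto simp: extension_edges_def)
    moreover have "f ((p @ [b]) @ [c]) \<noteq> f p"
      using inj_onD[OF bij_betw_imp_inj_on[OF f(1)] _ snoc.prems V'(2)] by auto
    ultimately show ?case unfolding d extension_edges_def by auto
  qed
  then show ?thesis using f by (simp add: tree_iso_def)
qed

lemma rooted_iso_list_graph_iff_tree_iso:
  assumes "prefix_closed V"
  shows "rooted_iso (list_graph V) (list_graph W) \<longleftrightarrow> (\<exists>f. tree_iso f V W)"
proof
  assume "rooted_iso (list_graph V) (list_graph W)"
  then show "\<exists>f. tree_iso f V W"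
    using adjacency_preserving_imp_tree_iso[OF assms, of _ W]
    by (auto simp: rooted_iso_def list_graph_def)
next
  assume "\<exists>f. tree_iso f V W"
  then obtain f where f: "tree_iso f V W" ..
  then show "rooted_iso (list_graph V) (list_graph W)"
    unfolding rooted_iso_def list_graph_def
    using tree_iso_bij_betw[OF f] tree_iso_Nil[OF f] tree_iso_adjacent_iff[OF f assms]
    by (intro exI[of _ f]) simp
qed

lemma tree_iso_Cons:
  assumes f: "tree_iso f V W" and V: "prefix_closed V" and "c # p \<in> V"
  shows "f (c # p) = hd (f [c]) # tl (f (c # p))"
  using assms(3)
proof (induction p rule: rev_induct)
  case Nil
  then show ?case
    using tree_iso_snoc[OF f, of "[]" c] tree_iso_Nil[OF f] by fastforce
next
  case (snoc d p)
  have "c # p \<in> V" using prefix_closed_appendD[OF V, of "c # p" "[d]"] snoc.prems by simp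
  then have "f (c # p) = hd (f [c]) # tl (f (c # p))" by (rule snoc.IH)
  moreover obtain e where "f (c # p @ [d]) = f (c # p) @ [e]"
    using tree_iso_snoc[OF f, of "c # p" d] snoc.prems by auto
  ultimately show ?case by (cases "f (c # p)") auto
qed

lemma tree_iso_preimage_Cons:
  assumes "tree_iso f V W" "prefix_closed V" "d # q \<in> W"
  shows "\<exists>c p. c # p \<in> V \<and> f (c # p) = d # q \<and> hd (f [c]) = d"
proof -
  obtain u where u: "u \<in> V" "f u = d # q"
    using bij_betw_imp_surj_on[OF tree_iso_bij_betw[OF assms(1)]] assms(3) by (metis imageE)
  then obtain c p where "u = c # p" using tree_iso_Nil[OF assms(1)] by (cases u) auto
  then show ?thesis using u tree_iso_Cons[OF assms(1,2), of c p] by auto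
qed

lemma tree_iso_first_steps:
  assumes f: "tree_iso f V W" and V: "prefix_closed V"
  shows "bij_betw (\<lambda>c. hd (f [c])) (first_steps V) (first_steps W)"
proof (rule bij_betw_imageI)
  have f_single: "f [c] = [hd (f [c])]" if "c \<in> first_steps V" for c
    using tree_iso_snoc[OF f, of "[]" c] tree_iso_Nil[OF f] that by (auto simp: first_steps_def)
  show "inj_on (\<lambda>c. hd (f [c])) (first_steps V)"
  proof (rule inj_onI)
    fix c d assume cd: "c \<in> first_steps V" "d \<in> first_steps V" "hd (f [c]) = hd (f [d])"
    then have "f [c] = f [d]" using f_single by metis
    then show "c = d"
      using tree_iso_eq_iff[OF f, of "[c]" "[d]"] cd by (simp add: first_steps_def)
  qed
  show "(\<lambda>c. hd (f [c])) ` first_steps V = first_steps W"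
  proof (intro equalityI subsetI)
    fix d assume "d \<in> (\<lambda>c. hd (f [c])) ` first_steps V"
    then obtain c where c: "c \<in> first_steps V" "d = hd (f [c])" by blast
    then have "f [c] \<in> W" using tree_iso_mem[OF f] by (simp add: first_steps_def)
    then show "d \<in> first_steps W" using f_single[OF c(1)] c(2) by (simp add: first_steps_def)
  next
    fix d assume "d \<in> first_steps W"
    then obtain c p where "c # p \<in> V" "hd (f [c]) = d"
      using tree_iso_preimage_Cons[OF f V, of d "[]"] by (auto simp: first_steps_def)
    then show "d \<in> (\<lambda>c. hd (f [c])) ` first_steps V"
      using prefix_closed_Cons_iff[OF V] by blast
  qed
qed

lemma tree_iso_subtree:
  assumes f: "tree_iso f V W" and V: "prefix_closed V" and c: "c \<in> first_steps V"
  shows "tree_iso (\<lambda>p. tl (f (c # p))) (subtree V c) (subtree W (hd (f [c])))"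
  unfolding tree_iso_def
proof (intro conjI allI impI bij_betw_imageI)
  note f_Cons = tree_iso_Cons[OF f V, of c]
  show "inj_on (\<lambda>p. tl (f (c # p))) (subtree V c)"
  proof (rule inj_onI)
    fix p q assume pq: "p \<in> subtree V c" "q \<in> subtree V c" "tl (f (c # p)) = tl (f (c # q))"
    then have "f (c # p) = f (c # q)" using f_Cons[of p] f_Cons[of q] by (simp add: subtree_def)
    then show "p = q"
      using tree_iso_eq_iff[OF f, of "c # p" "c # q"] pq by (simp add: subtree_def)
  qed
  show "(\<lambda>p. tl (f (c # p))) ` subtree V c = subtree W (hd (f [c]))"
  proof (intro equalityI subsetI)
    fix q assume "q \<in> (\<lambda>p. tl (f (c # p))) ` subtree V c"
    then obtain p where p: "c # p \<in> V" "q = tl (f (c # p))" by (auto simp: subtree_def)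
    then show "q \<in> subtree W (hd (f [c]))"
      using f_Cons[OF p(1)] tree_iso_mem[OF f p(1)] by (auto simp: subtree_def)
  next
    fix q assume "q \<in> subtree W (hd (f [c]))"
    then obtain b p where p: "b # p \<in> V" "f (b # p) = hd (f [c]) # q" "hd (f [b]) = hd (f [c])"
      using tree_iso_preimage_Cons[OF f V, of "hd (f [c])" q] by (auto simp: subtree_def)
    then have "b = c"
      using inj_onD[OF bij_betw_imp_inj_on[OF tree_iso_first_steps[OF f V]]] c
        prefix_closed_Cons_iff[OF V] by blast
    then show "q \<in> (\<lambda>p. tl (f (c # p))) ` subtree V c"
      using p by (auto simp: subtree_def intro!: image_eqI[of _ _ p])
  qed
  show "tl (f [c]) = []"
    using tree_iso_snoc[OF f, of "[]" c] tree_iso_Nil[OF f] c by (auto simp: first_steps_def)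
  fix p d assume "p @ [d] \<in> subtree V c"
  then have pd: "c # p @ [d] \<in> V" "c # p \<in> V"
    using prefix_closed_appendD[OF V, of "c # p" "[d]"] by (simp_all add: subtree_def)
  then show "\<exists>e. tl (f (c # p @ [d])) = tl (f (c # p)) @ [e]"
    using tree_iso_snoc[OF f, of "c # p" d] f_Cons[OF pd(2)] by (cases "f (c # p)") auto
qed

lemma bij_betw_glue_subtrees:
  assumes V: "prefix_closed V" and W: "prefix_closed W"
    and g: "bij_betw g (first_steps V) (first_steps W)"
    and F: "\<And>c. c \<in> first_steps V \<Longrightarrow> bij_betw (F c) (subtree V c) (subtree W (g c))"
  shows "bij_betw (\<lambda>p. case p of [] \<Rightarrow> [] | c # q \<Rightarrow> g c # F c q) V W" (is "bij_betw ?f V W")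
proof (rule bij_betw_imageI)
  note V_Cons = prefix_closed_Cons_iff[OF V]
  show "inj_on ?f V"
  proof (rule inj_onI)
    fix p q assume pq: "p \<in> V" "q \<in> V" "?f p = ?f q"
    show "p = q"
    proof (cases p; cases q)
      fix c p' d q' assume Cons: "p = c # p'" "q = d # q'"
      then have "c = d"
        using pq V_Cons inj_onD[OF bij_betw_imp_inj_on[OF g], of c d] by auto
      moreover have "p' = q'"
        using pq V_Cons Cons \<open>c = d\<close> inj_onD[OF bij_betw_imp_inj_on[OF F], of c p' q'] by auto
      ultimately show ?thesis by (simp add: Cons)
    qed (use pq in auto)
  qed
  have "?f ` V = insert [] (\<Union>c\<in>first_steps V. (#) (g c) ` F c ` subtree V c)"
    by (subst prefix_closed_eq_Cons_subtrees[OF V]) (simp add: image_UN image_image)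
  also have "\<dots> = insert [] (\<Union>c\<in>first_steps V. (#) (g c) ` subtree W (g c))"
    using bij_betw_imp_surj_on[OF F] by simp
  also have "\<dots> = insert [] (\<Union>d\<in>g ` first_steps V. (#) d ` subtree W d)"
    by simp
  also have "\<dots> = W"
    unfolding bij_betw_imp_surj_on[OF g] by (rule prefix_closed_eq_Cons_subtrees[OF W, symmetric])
  finally show "?f ` V = W" .
qed

lemma tree_iso_glue_subtrees:
  assumes V: "prefix_closed V" and W: "prefix_closed W"
    and g: "bij_betw g (first_steps V) (first_steps W)"
    and F: "\<And>c. c \<in> first_steps V \<Longrightarrow> tree_iso (F c) (subtree V c) (subtree W (g c))"
  shows "tree_iso (\<lambda>p. case p of [] \<Rightarrow> [] | c # q \<Rightarrow> g c # F c q) V W" (is "tree_iso ?f V W")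
  unfolding tree_iso_def
proof (intro conjI allI impI)
  show "bij_betw ?f V W"
    using bij_betw_glue_subtrees[OF V W g tree_iso_bij_betw[OF F]] .
  fix p c assume "p @ [c] \<in> V"
  then show "\<exists>d. ?f (p @ [c]) = ?f p @ [d]"
    using prefix_closed_Cons_iff[OF V] tree_iso_Nil[OF F] tree_iso_snoc[OF F] by (cases p) auto
qed simp

lemma image_mset_eq_imp_bij_betw:
  assumes "finite A" "finite B" "image_mset F (mset_set A) = image_mset F' (mset_set B)"
  shows "\<exists>g. bij_betw g A B \<and> (\<forall>a\<in>A. F a = F' (g a))"
proof -
  have "card A = card B" using assms(3) by (metis size_image_mset size_mset_set)
  then obtain e where e: "bij_betw e A B"
    using finite_same_card_bij[OF assms(1,2)] by blast
  then have "image_mset F (mset_set A) = image_mset (F' \<circ> e) (mset_set A)"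
    unfolding assms(3) bij_betw_def by (metis image_mset_mset_set multiset.map_comp)
  then obtain p where p: "p permutes A" "\<forall>a\<in>A. F a = (F' \<circ> e) (p a)"
    using image_mset_eq_implies_permutes[OF assms(1)] by blast
  show ?thesis
    using bij_betw_trans[OF permutes_imp_bij[OF p(1)] e] p(2) by (intro exI[of _ "e \<circ> p"]) auto
qed

text \<open>Where \<open>V\<close> branches infinitely, \<open>mset_set\<close> is empty and the node becomes a leaf.\<close>

primrec shape :: "nat \<Rightarrow> 'a list set \<Rightarrow> rtree" where
  "shape 0 V = Node {#}"
| "shape (Suc k) V = Node (image_mset (\<lambda>c. shape k (subtree V c)) (mset_set (first_steps V)))"

lemma shape_truncate: "shape k {p \<in> V. length p \<le> k} = shape k V"
proof (induction k arbitrary: V)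
  case (Suc k)
  have "subtree {p \<in> V. length p \<le> Suc k} c = {p \<in> subtree V c. length p \<le> k}" for c
    by (auto simp: subtree_def)
  moreover have "first_steps {p \<in> V. length p \<le> Suc k} = first_steps V"
    by (auto simp: first_steps_def)
  ultimately show ?case using Suc by simp
qed simp

lemma tree_iso_imp_shape_eq:
  assumes "tree_iso f V W" "prefix_closed V" "prefix_closed W"
  shows "shape k V = shape k W"
  using assms
proof (induction k arbitrary: f V W)
  case (Suc k)
  define g where "g c = hd (f [c])" for c
  have g: "bij_betw g (first_steps V) (first_steps W)"
    using tree_iso_first_steps[OF Suc.prems(1,2)] by (simp add: g_def[abs_def])
  have "shape k (subtree V c) = shape k (subtree W (g c))" if c: "c \<in> first_steps V" for c
  proof (rule Suc.IH)
    show "tree_iso (\<lambda>p. tl (f (c # p))) (subtree V c) (subtree W (g c))"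
      using tree_iso_subtree[OF Suc.prems(1,2) c] by (simp add: g_def)
    show "prefix_closed (subtree V c)" "prefix_closed (subtree W (g c))"
      using Suc.prems(2,3) c bij_betwE[OF g] by (auto intro: prefix_closed_subtree)
  qed
  then have "image_mset (\<lambda>c. shape k (subtree V c)) (mset_set (first_steps V)) =
      image_mset (\<lambda>c. shape k (subtree W (g c))) (mset_set (first_steps V))"
    by (cases "finite (first_steps V)") (auto intro!: image_mset_cong)
  also have "\<dots> = image_mset (\<lambda>d. shape k (subtree W d)) (image_mset g (mset_set (first_steps V)))"
    by (simp add: multiset.map_comp comp_def)
  also have "image_mset g (mset_set (first_steps V)) = mset_set (first_steps W)"
    using g by (simp add: bij_betw_def image_mset_mset_set)
  finally show ?case by simp
qed simp

lemma shape_eq_imp_tree_iso: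
  assumes "prefix_closed V" "prefix_closed W" "finitely_branching V" "finitely_branching W"
    and "\<And>p. p \<in> V \<Longrightarrow> length p \<le> k" "\<And>q. q \<in> W \<Longrightarrow> length q \<le> k" "shape k V = shape k W"
  shows "\<exists>f. tree_iso f V W"
  using assms
proof (induction k arbitrary: V W)
  case 0
  then have "V = {[]}" "W = {[]}" by (auto dest: prefix_closed_Nil)
  then show ?case by (auto simp: tree_iso_def bij_betw_def)
next
  case (Suc k)
  have "image_mset (\<lambda>c. shape k (subtree V c)) (mset_set (first_steps V)) =
      image_mset (\<lambda>d. shape k (subtree W d)) (mset_set (first_steps W))"
    using Suc.prems(7) by simp
  then obtain g where g: "bij_betw g (first_steps V) (first_steps W)"
    and shape: "\<And>c. c \<in> first_steps V \<Longrightarrow> shape k (subtree V c) = shape k (subtree W (g c))"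
    using image_mset_eq_imp_bij_betw[OF finite_first_steps[OF Suc.prems(3)]
        finite_first_steps[OF Suc.prems(4)]] by blast
  have "\<exists>f. tree_iso f (subtree V c) (subtree W (g c))" if c: "c \<in> first_steps V" for c
  proof (rule Suc.IH)
    show "prefix_closed (subtree V c)" "prefix_closed (subtree W (g c))"
      using Suc.prems(1,2) c bij_betwE[OF g] by (auto intro: prefix_closed_subtree)
    show "finitely_branching (subtree V c)" "finitely_branching (subtree W (g c))"
      using Suc.prems(3,4) by (auto intro: finitely_branching_subtree)
    show "length p \<le> k" if "p \<in> subtree V c" for p
      using Suc.prems(5)[of "c # p"] that by (simp add: subtree_def)
    show "length q \<le> k" if "q \<in> subtree W (g c)" for q
      using Suc.prems(6)[of "g c # q"] that by (simp add: subtree_def)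
    show "shape k (subtree V c) = shape k (subtree W (g c))" using shape[OF c] .
  qed
  then obtain F where "\<forall>c\<in>first_steps V. tree_iso (F c) (subtree V c) (subtree W (g c))"
    using bchoice[of "first_steps V" "\<lambda>c f. tree_iso f (subtree V c) (subtree W (g c))"] by blast
  then show ?case using tree_iso_glue_subtrees[OF Suc.prems(1,2) g, of F] by blast
qed

theorem rooted_iso_list_graph_iff_shape_eq:
  assumes "prefix_closed V" "prefix_closed W" "finitely_branching V" "finitely_branching W"
    and "\<And>p. p \<in> V \<Longrightarrow> length p \<le> k" "\<And>q. q \<in> W \<Longrightarrow> length q \<le> k"
  shows "rooted_iso (list_graph V) (list_graph W) \<longleftrightarrow> shape k V = shape k W"
  unfolding rooted_iso_list_graph_iff_tree_iso[OF assms(1)]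
  using tree_iso_imp_shape_eq[OF _ assms(1,2)] shape_eq_imp_tree_iso[OF assms] by blast

section \<open>Unlabeled rooted trees as path sets\<close>

lemma depth_child_less: "s \<in># children t \<Longrightarrow> depth s < depth t"
  by (cases t) (simp add: less_Suc_eq_le Max_ge_iff less_eq_Suc_le)

lemma tree_ball_eq_self: "depth t \<le> k \<Longrightarrow> tree_ball k t = t"
proof (induction k arbitrary: t)
  case 0
  then have "children t = {#}"
    using depth_child_less[of _ t] by (fastforce intro: multiset_nonemptyE)
  then show ?case by (cases t) simp
next
  case (Suc k)
  have "image_mset (tree_ball k) (children t) = image_mset id (children t)"
    using Suc.IH Suc.prems depth_child_less by (intro image_mset_cong) fastforce
  then show ?case by simp
qed

lemma tree_ball_tree_ball: "j \<le> k \<Longrightarrow> tree_ball j (tree_ball k t) = tree_ball j t"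
proof (induction j arbitrary: k t)
  case (Suc j)
  then show ?case by (cases k) (simp_all add: multiset.map_comp comp_def)
qed simp

definition paths :: "rtree \<Rightarrow> (rtree \<times> nat) list set" where
  "paths t = {p. path_in p t}"

lemma graph_of_tree_eq_list_graph: "graph_of_tree t = list_graph (paths t)"
  by (simp add: graph_of_tree_def list_graph_def paths_def)

lemma first_steps_paths: "first_steps (paths t) = {(s, i). i < count (children t) s}"
  by (auto simp: first_steps_def paths_def)

lemma subtree_paths: "c \<in> first_steps (paths t) \<Longrightarrow> subtree (paths t) c = paths (fst c)"
  by (auto simp: first_steps_def subtree_def paths_def)

lemma prefix_closed_paths: "prefix_closed (paths t)"
proof -
  have "path_in (p @ q) t \<Longrightarrow> path_in p t" for p q
    by (induction p arbitrary: t) auto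
  then show ?thesis by (auto simp: prefix_closed_def paths_def)
qed

lemma finite_multiset_copies: "finite {(s, i). i < count M s}"
proof -
  have "{(s, i). i < count M s} = (SIGMA s:set_mset M. {..<count M s})"
    by (auto simp flip: count_greater_zero_iff)
  then show ?thesis by simp
qed

lemma image_fst_multiset_copies: "image_mset fst (mset_set {(s, i). i < count M s}) = M"
proof (rule multiset_eqI)
  fix s
  have "{c \<in> {(s, i). i < count M s}. fst c = s} = Pair s ` {..<count M s}" by auto
  moreover have "card (Pair s ` {..<count M s}) = count M s"
    by (simp add: card_image inj_on_def)
  ultimately show "count (image_mset fst (mset_set {(s, i). i < count M s})) s = count M s"
    by (simp only: count_image_mset_eq_card_vimage[OF finite_multiset_copies])
qed

lemma finitely_branching_paths: "finitely_branching (paths t)"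
proof -
  have "finite {c. path_in (p @ [c]) t}" for p
  proof (induction p arbitrary: t)
    case Nil
    then show ?case using finite_multiset_copies[of "children t"] by (simp add: case_prod_unfold)
  qed simp
  then show ?thesis by (simp add: finitely_branching_def paths_def)
qed

lemma length_path_le_depth: "p \<in> paths t \<Longrightarrow> length p \<le> depth t"
  unfolding paths_def mem_Collect_eq
proof (induction p arbitrary: t)
  case (Cons c p)
  then have "fst c \<in># children t" by (auto simp flip: count_greater_zero_iff)
  then show ?case using Cons depth_child_less[of "fst c" t] by fastforce
qed simp

lemma shape_paths: "shape k (paths t) = tree_ball k t"
proof (induction k arbitrary: t)
  case (Suc k)
  have "image_mset (\<lambda>c. shape k (subtree (paths t) c)) (mset_set (first_steps (paths t))) =
      image_mset (\<lambda>c. tree_ball k (fst c)) (mset_set (first_steps (paths t)))"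
    using finite_multiset_copies[of "children t"]
    by (intro image_mset_cong) (simp add: Suc subtree_paths first_steps_paths)
  also have "\<dots> = image_mset (tree_ball k) (image_mset fst (mset_set (first_steps (paths t))))"
    by (simp add: multiset.map_comp comp_def)
  finally show ?case by (simp add: first_steps_paths image_fst_multiset_copies)
qed simp

section \<open>Universal covers\<close>

primrec cover_branch :: "nat \<Rightarrow> 'v rel \<Rightarrow> 'v \<Rightarrow> 'v \<Rightarrow> rtree" where
  "cover_branch 0 G u v = Node {#}"
| "cover_branch (Suc k) G u v =
     Node (image_mset (cover_branch k G v) (mset_set (G `` {v} - {u})))"

primrec cover_tree :: "nat \<Rightarrow> 'v rel \<Rightarrow> 'v \<Rightarrow> rtree" where
  "cover_tree 0 G x = Node {#}"
| "cover_tree (Suc k) G x = Node (image_mset (cover_branch k G x) (mset_set (G `` {x})))"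

definition walk_tails :: "'v rel \<Rightarrow> 'v \<Rightarrow> 'v list set" where
  "walk_tails G x = {p. x # p \<in> nb_walks G x}"

lemma nb_walks_Cons_Cons_iff:
  "u # v # w \<in> nb_walks G u \<longleftrightarrow>
     (u, v) \<in> G \<and> v # w \<in> nb_walks G v \<and> (w \<noteq> [] \<longrightarrow> u \<noteq> hd w)"
proof -
  let ?no_backtrack = "\<lambda>w k. k + 2 < length w \<longrightarrow> w ! k \<noteq> w ! (k + 2)"
  have "(\<forall>k. ?no_backtrack (u # v # w) k) \<longleftrightarrow>
      ?no_backtrack (u # v # w) 0 \<and> (\<forall>k. ?no_backtrack (u # v # w) (Suc k))"
    by (metis not0_implies_Suc)
  also have "\<dots> \<longleftrightarrow> (w \<noteq> [] \<longrightarrow> u \<noteq> hd w) \<and> (\<forall>k. ?no_backtrack (v # w) k)"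
    by (cases w) auto
  finally show ?thesis by (auto simp: nb_walks_def)
qed

lemma walk_tails_Nil: "[] \<in> walk_tails G x"
  by (simp add: walk_tails_def nb_walks_def)

lemma walk_tails_Cons_iff:
  "v # p \<in> walk_tails G u \<longleftrightarrow> (u, v) \<in> G \<and> p \<in> walk_tails G v \<and> (p \<noteq> [] \<longrightarrow> u \<noteq> hd p)"
  by (simp add: walk_tails_def nb_walks_Cons_Cons_iff)

lemma prefix_closed_walk_tails: "prefix_closed (walk_tails G x)"
proof -
  have "p @ q \<in> walk_tails G x \<Longrightarrow> p \<in> walk_tails G x" for p q
    by (induction p arbitrary: x) (auto simp: walk_tails_Nil walk_tails_Cons_iff)
  then show ?thesis by (auto simp: prefix_closed_def walk_tails_Nil)
qed

lemma finitely_branching_walk_tails: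
  assumes "\<And>v. finite (G `` {v})"
  shows "finitely_branching (walk_tails G x)"
proof -
  have "finite {c. p @ [c] \<in> walk_tails G x}" for p
  proof (induction p arbitrary: x)
    case Nil
    show ?case
      using assms[of x] by (rule rev_finite_subset) (auto simp: walk_tails_Cons_iff)
  next
    case (Cons v p)
    show ?case
      using Cons[of v] by (rule rev_finite_subset) (auto simp: walk_tails_Cons_iff)
  qed
  then show ?thesis by (simp add: finitely_branching_def)
qed

lemma first_steps_walk_tails: "first_steps (walk_tails G x) = G `` {x}"
  by (auto simp: first_steps_def walk_tails_Cons_iff walk_tails_Nil)

lemma first_steps_subtree_walk_tails:
  "(u, v) \<in> G \<Longrightarrow> first_steps (subtree (walk_tails G u) v) = G `` {v} - {u}"
  by (auto simp: first_steps_def subtree_def walk_tails_Cons_iff walk_tails_Nil)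

lemma subtree_subtree_walk_tails:
  "(u, v) \<in> G \<Longrightarrow> w \<noteq> u \<Longrightarrow> subtree (subtree (walk_tails G u) v) w = subtree (walk_tails G v) w"
  by (auto simp: subtree_def walk_tails_Cons_iff)

lemma shape_subtree_walk_tails:
  "(u, v) \<in> G \<Longrightarrow> shape k (subtree (walk_tails G u) v) = cover_branch k G u v"
proof (induction k arbitrary: u v)
  case (Suc k)
  then have "image_mset (\<lambda>w. shape k (subtree (subtree (walk_tails G u) v) w))
      (mset_set (G `` {v} - {u})) = image_mset (cover_branch k G v) (mset_set (G `` {v} - {u}))"
    by (cases "finite (G `` {v} - {u})")
      (auto simp: subtree_subtree_walk_tails intro!: image_mset_cong)
  then show ?case using Suc.prems by (simp add: first_steps_subtree_walk_tails)
qed simp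

lemma shape_walk_tails: "shape k (walk_tails G x) = cover_tree k G x"
proof (cases k)
  case (Suc j)
  have "image_mset (\<lambda>v. shape j (subtree (walk_tails G x) v)) (mset_set (G `` {x})) =
      image_mset (cover_branch j G x) (mset_set (G `` {x}))"
    by (cases "finite (G `` {x})") (auto simp: shape_subtree_walk_tails intro!: image_mset_cong)
  then show ?thesis by (simp add: Suc first_steps_walk_tails)
qed simp

lemma universal_cover_iso_list_graph:
  "rooted_iso (list_graph (walk_tails G x)) (universal_cover G x)"
proof -
  have "(#) x ` walk_tails G x = nb_walks G x"
  proof (intro equalityI subsetI)
    fix w assume "w \<in> nb_walks G x"
    then show "w \<in> (#) x ` walk_tails G x"
      by (cases w) (auto simp: walk_tails_def nb_walks_def)
  qed (auto simp: walk_tails_def)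
  then have "bij_betw ((#) x) (walk_tails G x) (nb_walks G x)" by (simp add: bij_betw_def)
  then show ?thesis
    unfolding rooted_iso_def list_graph_def universal_cover_def
    by (intro exI[of _ "(#) x"]) (auto simp: extension_edges_def walk_tails_def)
qed

lemma universal_cover_ball_iso_list_graph:
  "rooted_iso (list_graph {p \<in> walk_tails G x. length p \<le> k}) (graph_ball k (universal_cover G x))"
  unfolding graph_ball_list_graph[OF prefix_closed_walk_tails, symmetric]
proof (rule rooted_iso_graph_ball[OF universal_cover_iso_list_graph])
  show "root (list_graph (walk_tails G x)) \<in> verts (list_graph (walk_tails G x))"
    by (simp add: list_graph_def walk_tails_Nil)
qed (auto simp: list_graph_def universal_cover_def extension_edges_def)

theorem universal_cover_ball_iso_iff:
  assumes "\<And>v. finite (G `` {v})" "depth t \<le> k"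
  shows "rooted_iso (graph_ball k (universal_cover G x)) (graph_of_tree t) \<longleftrightarrow> t = cover_tree k G x"
proof -
  let ?V = "{p \<in> walk_tails G x. length p \<le> k}"
  have ball: "rooted_iso (list_graph ?V) (graph_ball k (universal_cover G x))"
    by (rule universal_cover_ball_iso_list_graph)
  moreover have "root (list_graph ?V) \<in> verts (list_graph ?V)"
    by (simp add: list_graph_def walk_tails_Nil)
  ultimately have "rooted_iso (graph_ball k (universal_cover G x)) (graph_of_tree t) \<longleftrightarrow>
      rooted_iso (list_graph ?V) (list_graph (paths t))"
    unfolding graph_of_tree_eq_list_graph by (meson rooted_iso_sym rooted_iso_trans)
  also have "\<dots> \<longleftrightarrow> shape k ?V = shape k (paths t)"
  proof (rule rooted_iso_list_graph_iff_shape_eq)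
    show "finitely_branching ?V"
      by (rule finitely_branching_mono[OF _ finitely_branching_walk_tails[OF assms(1)]]) auto
    show "length q \<le> k" if "q \<in> paths t" for q
      using length_path_le_depth[OF that] assms(2) by simp
  qed (auto intro: prefix_closed_truncate prefix_closed_walk_tails prefix_closed_paths
      finitely_branching_paths)
  also have "\<dots> \<longleftrightarrow> t = cover_tree k G x"
    by (auto simp: shape_truncate shape_walk_tails shape_paths tree_ball_eq_self[OF assms(2)])
  finally show ?thesis .
qed

lemma tree_ball_cover_branch: "j \<le> k \<Longrightarrow> tree_ball j (cover_branch k G u v) = cover_branch j G u v"
proof (induction j arbitrary: k u v)
  case (Suc j)
  then obtain k' where k: "k = Suc k'" by (cases k) auto
  have "image_mset (\<lambda>w. tree_ball j (cover_branch k' G v w)) M =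
      image_mset (cover_branch j G v) M" for M
    using Suc k by (intro image_mset_cong) auto
  then show ?case by (simp add: k multiset.map_comp comp_def)
qed simp

section \<open>Edge types\<close>

lemma type_degree_eq:
  "type_degree h (r, s) t = (if edge_type h t s = (r, s) then count (children t) s else 0)"
proof -
  have "{#s' \<in># children t. edge_type h t s' = (r, s)#} =
      {#s' \<in># children t. s' = s \<and> edge_type h t s = (r, s)#}"
    by (intro filter_mset_cong) (auto simp: edge_type_def)
  then show ?thesis by (simp add: type_degree_def filter_eq_replicate_mset)
qed

lemma type_degree_pos_iff:
  "0 < type_degree h (r, s) t \<longleftrightarrow> s \<in># children t \<and> edge_type h t s = (r, s)"
  by (simp add: type_degree_eq)

lemma type_degree_edge_type: "type_degree h (edge_type h t s) t = count (children t) s"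
  by (simp add: edge_type_def type_degree_eq)

lemma type_degree_eq_0: "\<tau> \<notin> types h n t \<Longrightarrow> i \<in> {1..n} \<Longrightarrow> type_degree h \<tau> (t i) = 0"
  using type_degree_pos_iff[of h "fst \<tau>" "snd \<tau>" "t i"] by (force simp: types_def)

lemma children_tree_ball_edge_type:
  assumes "0 < type_degree (Suc m) (r, s) t" "k < m"
  shows "children (tree_ball (Suc k) t) = add_mset (tree_ball k s) (children (tree_ball (Suc k) r))"
proof -
  have s: "s \<in># children t" and r: "r = tree_ball m (Node (children t - {#s#}))"
    using assms(1) by (simp_all add: type_degree_pos_iff edge_type_def)
  have "children (tree_ball (Suc k) r) = image_mset (tree_ball k) (children t - {#s#})"
    unfolding r using assms(2) by (subst tree_ball_tree_ball) simp_all
  moreover have "children t = add_mset s (children t - {#s#})" using s by simp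
  ultimately show ?thesis by (metis image_mset_add_mset rtree.sel tree_ball.simps(2))
qed

lemma tree_ball_edge_type:
  assumes "depth t \<le> Suc m" "0 < type_degree (Suc m) (r, s) t"
  shows "tree_ball m r = r" "tree_ball m s = s"
proof -
  have s: "s \<in># children t" and r: "r = tree_ball m (Node (children t - {#s#}))"
    using assms(2) by (simp_all add: type_degree_pos_iff edge_type_def)
  show "tree_ball m r = r" unfolding r by (simp add: tree_ball_tree_ball)
  show "tree_ball m s = s" using tree_ball_eq_self depth_child_less[OF s] assms(1) by simp
qed

text \<open>By induction on the radius, cancelling at each step the branch along the edge, whose ball of
  smaller radius is already known.\<close>

lemma edge_type_unique:
  assumes "depth t \<le> Suc m" "depth u \<le> Suc m"
    and rs: "0 < type_degree (Suc m) (r, s) t" "0 < type_degree (Suc m) (s, r) u"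
    and rs': "0 < type_degree (Suc m) (r', s') t" "0 < type_degree (Suc m) (s', r') u"
  shows "(r, s) = (r', s')"
proof -
  have "k \<le> m \<Longrightarrow> tree_ball k r = tree_ball k r' \<and> tree_ball k s = tree_ball k s'" for k
  proof (induction k)
    case (Suc k)
    then have "tree_ball k r = tree_ball k r'" "tree_ball k s = tree_ball k s'" "k < m" by auto
    then have "children (tree_ball (Suc k) r) = children (tree_ball (Suc k) r')"
        "children (tree_ball (Suc k) s) = children (tree_ball (Suc k) s')"
      using rs[THEN children_tree_ball_edge_type, of k] rs'[THEN children_tree_ball_edge_type, of k]
      by simp_all
    then show ?case by (metis rtree.expand)
  qed simp
  from this[of m] show ?thesis
    using tree_ball_edge_type[OF assms(1) rs(1)] tree_ball_edge_type[OF assms(1) rs'(1)] by simp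
qed

definition arcs_of_type :: "nat \<Rightarrow> 'v rel \<Rightarrow> rtree \<times> rtree \<Rightarrow> 'v rel" where
  "arcs_of_type m G \<tau> = {(x, y) \<in> G. (cover_branch m G y x, cover_branch m G x y) = \<tau>}"

lemma edge_type_cover_tree:
  assumes "finite (G `` {x})" "(x, y) \<in> G"
  shows "edge_type (Suc m) (cover_tree (Suc m) G x) (cover_branch m G x y) =
    (cover_branch m G y x, cover_branch m G x y)"
proof -
  have "image_mset (cover_branch m G x) (mset_set (G `` {x})) - {#cover_branch m G x y#} =
      image_mset (cover_branch m G x) (mset_set (G `` {x} - {y}))"
    using mset_set.remove[OF assms(1), of y] assms(2) by simp
  moreover have "tree_ball m (Node (image_mset (cover_branch m G x) (mset_set (G `` {x} - {y})))) =
      cover_branch m G y x"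
  proof (cases m)
    case (Suc k)
    have "(\<lambda>z. tree_ball k (cover_branch (Suc k) G x z)) = cover_branch k G x"
      by (intro ext tree_ball_cover_branch) simp
    then show ?thesis
      unfolding Suc tree_ball.simps cover_branch.simps(2) rtree.sel multiset.map_comp comp_def
      by simp
  qed simp
  ultimately show ?thesis by (simp add: edge_type_def)
qed

lemma type_degree_cover_tree:
  assumes "finite (G `` {x})"
  shows "type_degree (Suc m) \<tau> (cover_tree (Suc m) G x) = card (arcs_of_type m G \<tau> `` {x})"
proof -
  let ?T = "cover_tree (Suc m) G x"
  have "type_degree (Suc m) \<tau> ?T =
      card {y \<in> G `` {x}. edge_type (Suc m) ?T (cover_branch m G x y) = \<tau>}"
    using assms by (simp add: type_degree_def filter_mset_image_mset)
  also have "{y \<in> G `` {x}. edge_type (Suc m) ?T (cover_branch m G x y) = \<tau>} =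
      arcs_of_type m G \<tau> `` {x}"
    using edge_type_cover_tree[OF assms] by (auto simp: arcs_of_type_def simp del: cover_tree.simps)
  finally show ?thesis .
qed

section \<open>Decompositions into arcs of one type\<close>

definition realizes_type :: "nat \<Rightarrow> nat \<Rightarrow> (nat \<Rightarrow> rtree) \<Rightarrow> rtree \<times> rtree \<Rightarrow> nat rel \<Rightarrow> bool" where
  "realizes_type h n t \<tau> D \<longleftrightarrow> simple_digraph n D \<and>
     (\<forall>i\<in>{1..n}. card (D `` {i}) = type_degree h \<tau> (t i) \<and>
       card (D\<inverse> `` {i}) = type_degree h (prod.swap \<tau>) (t i))"

locale type_decomposition =
  fixes h n :: nat and t :: "nat \<Rightarrow> rtree" and E :: "rtree \<times> rtree \<Rightarrow> nat rel"
  assumes realizes: "realizes_type h n t \<tau> (E \<tau>)"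
    and swap: "E (prod.swap \<tau>) = (E \<tau>)\<inverse>"

lemma simple_graph_iff_simple_digraph: "simple_graph n G \<longleftrightarrow> simple_digraph n G \<and> sym G"
  by (auto simp: simple_graph_def simple_digraph_def)

lemma simple_digraph_finite_Image: "simple_digraph n D \<Longrightarrow> finite (D `` {i})"
  by (rule finite_Image) (auto simp: simple_digraph_def intro: finite_subset)

lemma digraphical_seq_type_degree_iff:
  "digraphical_seq n (\<lambda>i. type_degree h \<tau> (t i)) (\<lambda>i. type_degree h (prod.swap \<tau>) (t i)) \<longleftrightarrow>
    (\<exists>D. realizes_type h n t \<tau> D)"
  by (simp add: digraphical_seq_def realizes_type_def)

lemma graphical_seq_type_degree_iff:
  "graphical_seq n (\<lambda>i. type_degree h (r, r) (t i)) \<longleftrightarrow> (\<exists>D. sym D \<and> realizes_type h n t (r, r) D)"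
proof -
  have "simple_graph n D \<and> (\<forall>i\<in>{1..n}. card (D `` {i}) = type_degree h (r, r) (t i)) \<longleftrightarrow>
      sym D \<and> realizes_type h n t (r, r) D" for D
    by (cases "sym D")
      (simp_all add: realizes_type_def simple_graph_iff_simple_digraph sym_conv_converse_eq)
  then show ?thesis by (simp add: graphical_seq_def)
qed

lemma realizes_type_converse:
  "realizes_type h n t \<tau> D \<Longrightarrow> realizes_type h n t (prod.swap \<tau>) (D\<inverse>)"
  by (auto simp: realizes_type_def simple_digraph_def irrefl_def)

lemma realizes_type_empty:
  "\<tau> \<notin> types h n t \<Longrightarrow> prod.swap \<tau> \<notin> types h n t \<Longrightarrow> realizes_type h n t \<tau> {}"
  by (simp add: realizes_type_def simple_digraph_def irrefl_def type_degree_eq_0)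

text \<open>The representative \<open>rep \<tau>\<close> depends only on the pair \<open>{\<tau>, prod.swap \<tau>}\<close>, so relations chosen
  for the representatives extend to all types by converses.\<close>

lemma ex_type_decomposition:
  assumes "\<And>\<tau>. \<exists>D. realizes_type h n t \<tau> D"
    and "\<And>r. \<exists>D. sym D \<and> realizes_type h n t (r, r) D"
  shows "\<exists>E. type_decomposition h n t E"
proof -
  have "\<exists>D. realizes_type h n t \<tau> D \<and> (fst \<tau> = snd \<tau> \<longrightarrow> sym D)" for \<tau>
    using assms(1)[of \<tau>] assms(2)[of "fst \<tau>"] by (cases \<tau>) auto
  then obtain D where D: "\<And>\<tau>. realizes_type h n t \<tau> (D \<tau>)"
    "\<And>\<tau>. fst \<tau> = snd \<tau> \<Longrightarrow> sym (D \<tau>)"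
    by metis
  define rep where "rep \<tau> = (SOME \<sigma>. \<sigma> \<in> {\<tau>, prod.swap \<tau>})" for \<tau> :: "rtree \<times> rtree"
  have rep: "rep \<tau> = \<tau> \<or> rep \<tau> = prod.swap \<tau>" for \<tau>
    using someI[of "\<lambda>\<sigma>. \<sigma> \<in> {\<tau>, prod.swap \<tau>}" \<tau>] by (auto simp: rep_def)
  have rep_swap: "rep (prod.swap \<tau>) = rep \<tau>" for \<tau>
    by (simp add: rep_def insert_commute)
  define E where "E \<tau> = (if rep \<tau> = \<tau> then D \<tau> else (D (prod.swap \<tau>))\<inverse>)" for \<tau>
  have "realizes_type h n t \<tau> (E \<tau>)" for \<tau>
    using D(1)[of \<tau>] realizes_type_converse[OF D(1), of "prod.swap \<tau>"] by (simp add: E_def)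
  moreover have "E (prod.swap \<tau>) = (E \<tau>)\<inverse>" for \<tau>
  proof (cases "fst \<tau> = snd \<tau>")
    case True
    then have "prod.swap \<tau> = \<tau>" by (metis prod.collapse swap_simp)
    then show ?thesis using rep[of \<tau>] D(2)[OF True] by (simp add: E_def sym_conv_converse_eq)
  next
    case False
    then have "prod.swap \<tau> \<noteq> \<tau>" by (metis fst_swap)
    then show ?thesis using rep[of \<tau>] by (auto simp: E_def rep_swap)
  qed
  ultimately show ?thesis by (intro exI[of _ E] type_decomposition.intro)
qed

lemma ex_realizes_diagonal_type:
  assumes "\<forall>\<tau> \<in> diagonal_types h n t. graphical_seq n (\<lambda>i. type_degree h \<tau> (t i))"
  shows "\<exists>D. sym D \<and> realizes_type h n t (r, r) D"
proof (cases "(r, r) \<in> types h n t")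
  case True
  then show ?thesis
    using assms graphical_seq_type_degree_iff by (auto simp: diagonal_types_def)
next
  case False
  then show ?thesis using realizes_type_empty[of "(r, r)" h n t] by (auto intro: exI[of _ "{}"])
qed

lemma ex_realizes_type:
  assumes A: "orientation (types h n t) A"
    and diag_seqs: "\<forall>\<tau> \<in> diagonal_types h n t. graphical_seq n (\<lambda>i. type_degree h \<tau> (t i))"
    and A_seqs: "\<forall>\<tau> \<in> A. digraphical_seq n (\<lambda>i. type_degree h \<tau> (t i))
                             (\<lambda>i. type_degree h (prod.swap \<tau>) (t i))"
  shows "\<exists>D. realizes_type h n t (r, s) D"
proof -
  have realizes_A: "\<exists>D. realizes_type h n t \<tau> D" if "\<tau> \<in> A" for \<tau>
    using A_seqs that digraphical_seq_type_degree_iff by blast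
  consider (diagonal) "r = s" | (in_A) "(r, s) \<in> A" | (swap_in_A) "(s, r) \<in> A"
    | (absent) "(r, s) \<notin> types h n t" "(s, r) \<notin> types h n t"
    using A unfolding orientation_def by fast
  then show ?thesis
  proof cases
    case diagonal
    then show ?thesis using ex_realizes_diagonal_type[OF diag_seqs] by blast
  next
    case in_A
    then show ?thesis by (rule realizes_A)
  next
    case swap_in_A
    then obtain D where "realizes_type h n t (s, r) D" using realizes_A by blast
    from realizes_type_converse[OF this] show ?thesis by auto
  next
    case absent
    then show ?thesis using realizes_type_empty[of "(r, s)" h n t] by auto
  qed
qed

lemma ex_type_decomposition_iff:
  assumes "orientation (types h n t) A"
  shows "(\<exists>E. type_decomposition h n t E) \<longleftrightarrow>
    (\<forall>\<tau> \<in> diagonal_types h n t. graphical_seq n (\<lambda>i. type_degree h \<tau> (t i))) \<and>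
    (\<forall>\<tau> \<in> A. digraphical_seq n (\<lambda>i. type_degree h \<tau> (t i))
                             (\<lambda>i. type_degree h (prod.swap \<tau>) (t i)))"
    (is "_ \<longleftrightarrow> ?diagonal \<and> ?oriented")
proof
  assume "\<exists>E. type_decomposition h n t E"
  then obtain E where "type_decomposition h n t E" ..
  then interpret type_decomposition h n t E .
  have "sym (E (r, r))" for r
    using swap[of "(r, r)"] by (simp add: sym_conv_converse_eq)
  then show "?diagonal \<and> ?oriented"
    using realizes
    by (auto simp: diagonal_types_def graphical_seq_type_degree_iff digraphical_seq_type_degree_iff)
next
  assume "?diagonal \<and> ?oriented"
  then show "\<exists>E. type_decomposition h n t E"
    using ex_type_decomposition[of h n t] ex_realizes_diagonal_type[of h n t]
      ex_realizes_type[OF assms] by (metis surj_pair)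
qed

lemma type_decomposition_arcs_of_type:
  assumes "simple_graph n G" "\<And>i. i \<in> {1..n} \<Longrightarrow> t i = cover_tree (Suc m) G i"
  shows "type_decomposition (Suc m) n t (arcs_of_type m G)"
proof
  have G: "simple_digraph n G" "sym G"
    using assms(1) by (simp_all add: simple_graph_iff_simple_digraph)
  show swap: "arcs_of_type m G (prod.swap \<tau>) = (arcs_of_type m G \<tau>)\<inverse>" for \<tau>
    using G(2) by (cases \<tau>) (auto simp: arcs_of_type_def sym_def)
  have "card (arcs_of_type m G \<tau> `` {i}) = type_degree (Suc m) \<tau> (t i)" if "i \<in> {1..n}" for \<tau> i
    using type_degree_cover_tree[OF simple_digraph_finite_Image[OF G(1)]] assms(2)[OF that] by simp
  moreover have "simple_digraph n (arcs_of_type m G \<tau>)" for \<tau>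
    using G(1) by (auto simp: simple_digraph_def irrefl_def arcs_of_type_def)
  ultimately show "realizes_type (Suc m) n t \<tau> (arcs_of_type m G \<tau>)" for \<tau>
    by (simp add: realizes_type_def swap[symmetric])
qed

locale bounded_type_decomposition = type_decomposition "Suc m" n t E
  for m n :: nat and t :: "nat \<Rightarrow> rtree" and E :: "rtree \<times> rtree \<Rightarrow> nat rel" +
  assumes depth_le: "i \<in> {1..n} \<Longrightarrow> depth (t i) \<le> Suc m"
begin

definition arcs :: "nat rel" where
  "arcs = (\<Union>\<tau>. E \<tau>)"

definition arc_type :: "nat \<Rightarrow> nat \<Rightarrow> rtree \<times> rtree" where
  "arc_type i j = (THE \<tau>. (i, j) \<in> E \<tau>)"

definition branch_along :: "nat \<Rightarrow> nat \<Rightarrow> rtree" where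
  "branch_along i j = snd (arc_type i j)"

lemma simple_digraph_E: "simple_digraph n (E \<tau>)"
  using realizes by (simp add: realizes_type_def)

lemma card_E: "i \<in> {1..n} \<Longrightarrow> card (E \<tau> `` {i}) = type_degree (Suc m) \<tau> (t i)"
  using realizes by (simp add: realizes_type_def)

lemma simple_graph_arcs: "simple_graph n arcs"
proof -
  have "(j, i) \<in> E (prod.swap \<tau>)" if "(i, j) \<in> E \<tau>" for i j \<tau>
    using that by (simp add: swap)
  then have "sym arcs" unfolding arcs_def sym_def by blast
  then show ?thesis
    using simple_digraph_E
    unfolding simple_graph_iff_simple_digraph simple_digraph_def arcs_def irrefl_def by blast
qed

lemma finite_arcs_Image: "finite (arcs `` {i})"
  using simple_graph_arcs simple_digraph_finite_Image
  unfolding simple_graph_iff_simple_digraph by blast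

lemma E_subset_arcs: "E \<tau> \<subseteq> arcs"
  by (auto simp: arcs_def)

lemma arcs_vertices: "(i, j) \<in> arcs \<Longrightarrow> i \<in> {1..n} \<and> j \<in> {1..n}"
  using simple_graph_arcs unfolding simple_graph_def by blast

lemma E_swap_iff: "(j, i) \<in> E (s, r) \<longleftrightarrow> (i, j) \<in> E (r, s)"
  using swap[of "(r, s)"] by auto

lemma type_degree_pos_of_arc:
  assumes "(i, j) \<in> E \<tau>"
  shows "0 < type_degree (Suc m) \<tau> (t i)"
proof -
  have "i \<in> {1..n}" using arcs_vertices E_subset_arcs assms by blast
  moreover have "0 < card (E \<tau> `` {i})"
    using assms simple_digraph_finite_Image[OF simple_digraph_E] by (auto simp: card_gt_0_iff)
  ultimately show ?thesis by (simp add: card_E)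
qed

lemma arc_type_unique:
  assumes "(i, j) \<in> E \<tau>" "(i, j) \<in> E \<sigma>"
  shows "\<tau> = \<sigma>"
proof (cases \<tau>; cases \<sigma>)
  fix r s r' s' assume types: "\<tau> = (r, s)" "\<sigma> = (r', s')"
  have "depth (t i) \<le> Suc m" "depth (t j) \<le> Suc m"
    using depth_le arcs_vertices E_subset_arcs assms(1) by blast+
  then show ?thesis
    using assms type_degree_pos_of_arc E_swap_iff unfolding types
    by (intro edge_type_unique[of "t i" m "t j"]) blast+
qed

lemma arc_type_eq: "(i, j) \<in> E \<tau> \<Longrightarrow> arc_type i j = \<tau>"
  unfolding arc_type_def using arc_type_unique by blast

lemma branch_along_eq: "(i, j) \<in> E (r, s) \<Longrightarrow> branch_along i j = s"
  by (simp add: branch_along_def arc_type_eq)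

lemma arc_in_branch_class:
  assumes "(i, j) \<in> arcs"
  shows "(i, j) \<in> E (branch_along j i, branch_along i j)"
proof -
  obtain r s where "(i, j) \<in> E (r, s)" using assms by (auto simp: arcs_def)
  then show ?thesis using branch_along_eq E_swap_iff by metis
qed

lemma edge_type_branch_along:
  assumes "(i, j) \<in> arcs"
  shows "edge_type (Suc m) (t i) (branch_along i j) = (branch_along j i, branch_along i j)"
  using type_degree_pos_of_arc[OF arc_in_branch_class[OF assms]] by (simp add: type_degree_pos_iff)

lemma children_eq_branches:
  assumes "i \<in> {1..n}"
  shows "children (t i) = image_mset (branch_along i) (mset_set (arcs `` {i}))"
proof (rule multiset_eqI)
  fix s
  have "E (edge_type (Suc m) (t i) s) `` {i} = {j \<in> arcs `` {i}. branch_along i j = s}"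
  proof (intro equalityI subsetI)
    fix j assume "j \<in> E (edge_type (Suc m) (t i) s) `` {i}"
    then show "j \<in> {j \<in> arcs `` {i}. branch_along i j = s}"
      using branch_along_eq by (auto simp: arcs_def edge_type_def)
  next
    fix j assume "j \<in> {j \<in> arcs `` {i}. branch_along i j = s}"
    then show "j \<in> E (edge_type (Suc m) (t i) s) `` {i}"
      using edge_type_branch_along arc_in_branch_class by auto
  qed
  then have "count (children (t i)) s = card {j \<in> arcs `` {i}. branch_along i j = s}"
    using card_E[OF assms] type_degree_edge_type by metis
  then show "count (children (t i)) s =
      count (image_mset (branch_along i) (mset_set (arcs `` {i}))) s"
    by (simp only: count_image_mset_eq_card_vimage[OF finite_arcs_Image])
qed

lemma branch_along_unfold:
  assumes "(i, j) \<in> arcs"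
  shows "branch_along i j =
    tree_ball m (Node (image_mset (branch_along j) (mset_set (arcs `` {j} - {i}))))"
proof -
  have ji: "(j, i) \<in> arcs" using simple_graph_arcs assms by (auto simp: simple_graph_def sym_def)
  then have "branch_along i j = tree_ball m (Node (children (t j) - {#branch_along j i#}))"
    using edge_type_branch_along by (simp add: edge_type_def)
  also have "children (t j) - {#branch_along j i#} =
      image_mset (branch_along j) (mset_set (arcs `` {j} - {i}))"
    using children_eq_branches[of j] arcs_vertices[OF ji] ji
      mset_set.remove[OF finite_arcs_Image, of i j] by simp
  finally show ?thesis .
qed

lemma tree_ball_branch_along:
  "k \<le> m \<Longrightarrow> (i, j) \<in> arcs \<Longrightarrow> tree_ball k (branch_along i j) = cover_branch k arcs i j"
proof (induction k arbitrary: i j)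
  case (Suc k)
  have "tree_ball (Suc k) (branch_along i j) =
      tree_ball (Suc k) (Node (image_mset (branch_along j) (mset_set (arcs `` {j} - {i}))))"
    using branch_along_unfold[OF Suc.prems(2)] Suc.prems(1) by (metis tree_ball_tree_ball)
  also have "\<dots> =
      Node (image_mset (\<lambda>l. tree_ball k (branch_along j l)) (mset_set (arcs `` {j} - {i})))"
    by (simp add: multiset.map_comp comp_def)
  also have "\<dots> = cover_branch (Suc k) arcs i j"
    using Suc.IH Suc.prems(1) finite_arcs_Image by (auto intro!: image_mset_cong)
  finally show ?case .
qed simp

lemma eq_cover_tree_arcs:
  assumes "i \<in> {1..n}"
  shows "t i = cover_tree (Suc m) arcs i"
proof -
  have "t i = tree_ball (Suc m) (t i)" by (simp only: tree_ball_eq_self[OF depth_le[OF assms]])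
  also have "\<dots> = Node (image_mset (\<lambda>j. tree_ball m (branch_along i j)) (mset_set (arcs `` {i})))"
    by (simp add: children_eq_branches[OF assms] multiset.map_comp comp_def)
  also have "\<dots> = cover_tree (Suc m) arcs i"
    using tree_ball_branch_along finite_arcs_Image by (auto intro!: image_mset_cong)
  finally show ?thesis .
qed

end

lemma graphical_nbhd_iff_cover_tree:
  assumes "\<And>i. i \<in> {1..n} \<Longrightarrow> depth (t i) \<le> h"
  shows "graphical_nbhd h n t \<longleftrightarrow> (\<exists>G. simple_graph n G \<and> (\<forall>i\<in>{1..n}. t i = cover_tree h G i))"
proof -
  have "rooted_iso (graph_ball h (universal_cover G i)) (graph_of_tree (t i)) \<longleftrightarrow>
      t i = cover_tree h G i"
    if "simple_graph n G" "i \<in> {1..n}" for G i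
    using that assms simple_digraph_finite_Image
    by (intro universal_cover_ball_iso_iff) (auto simp: simple_graph_iff_simple_digraph)
  then show ?thesis by (auto simp: graphical_nbhd_def)
qed

lemma graphical_nbhd_iff_type_decomposition:
  assumes depth: "\<And>i. i \<in> {1..n} \<Longrightarrow> depth (t i) \<le> Suc m"
  shows "graphical_nbhd (Suc m) n t \<longleftrightarrow> (\<exists>E. type_decomposition (Suc m) n t E)"
proof -
  have "graphical_nbhd (Suc m) n t \<longleftrightarrow>
      (\<exists>G. simple_graph n G \<and> (\<forall>i\<in>{1..n}. t i = cover_tree (Suc m) G i))"
    by (rule graphical_nbhd_iff_cover_tree) (rule depth)
  also have "\<dots> \<longleftrightarrow> (\<exists>E. type_decomposition (Suc m) n t E)"
  proof
    assume "\<exists>G. simple_graph n G \<and> (\<forall>i\<in>{1..n}. t i = cover_tree (Suc m) G i)"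
    then show "\<exists>E. type_decomposition (Suc m) n t E"
      using type_decomposition_arcs_of_type by blast
  next
    assume "\<exists>E. type_decomposition (Suc m) n t E"
    then obtain E where "type_decomposition (Suc m) n t E" ..
    then interpret bounded_type_decomposition m n t E
      using depth
      by (intro bounded_type_decomposition.intro bounded_type_decomposition_axioms.intro)
    show "\<exists>G. simple_graph n G \<and> (\<forall>i\<in>{1..n}. t i = cover_tree (Suc m) G i)"
      using simple_graph_arcs eq_cover_tree_arcs by blast
  qed
  finally show ?thesis .
qed

theorem theorem1p3:
  fixes h n :: nat and t :: "nat \<Rightarrow> rtree" and A :: "(rtree \<times> rtree) set"
  assumes "h \<ge> 1" and "n \<ge> 1"
    and "\<And>i. i \<in> {1..n} \<Longrightarrow> depth (t i) \<le> h"
    and "orientation (types h n t) A"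
  shows "graphical_nbhd h n t \<longleftrightarrow>
    (\<forall>\<tau> \<in> diagonal_types h n t. graphical_seq n (\<lambda>i. type_degree h \<tau> (t i))) \<and>
    (\<forall>\<tau> \<in> A. digraphical_seq n (\<lambda>i. type_degree h \<tau> (t i))
                             (\<lambda>i. type_degree h (prod.swap \<tau>) (t i)))"
proof -
  obtain m where h: "h = Suc m" using assms(1) by (cases h) auto
  have "graphical_nbhd h n t \<longleftrightarrow> (\<exists>E. type_decomposition h n t E)"
    unfolding h using assms(3) h by (intro graphical_nbhd_iff_type_decomposition) simp
  then show ?thesis
    by (simp only: ex_type_decomposition_iff[OF assms(4)])
qed

end
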